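(* Let $K$ be a real, continuous and isotropic kernel on $S^\infty\times S^\infty$, with isotropic part $f:[-1,1]^2\to\mathbb{R}$. Then $K$ is positive definite on $S^\infty\times S^\infty$ if and only if there exist real numbers $f_{k,l}\ge0$, $k,l\in\mathbb{Z}_+$, with $\sum_{k,l=0}^\infty f_{k,l}<\infty$ such that $$f(t,s)=\sum_{k,l=0}^\infty f_{k,l}\,t^ks^l,\qquad t,s\in[-1,1].$$
   Context: $\mathbb{Z}_+=\{0,1,2,\ldots\}$. $S^\infty$ is the unit sphere of the real Hilbert space $\ell^2$, endowed with its geodesic distance; $\cdot$ denotes the inner product of $\ell^2$. A kernel $K$ on $S^\infty\times S^\infty$ is isotropic if $K((x,z),(y,w))=f(x\cdot y,z\cdot w)$ for all $x,y,z,w\in S^\infty$, for some function $f:[-1,1]^2\to\mathbb{R}$, called the isotropic part of $K$. A kernel $K$ on a nonempty set $X$ is positive definite if $\sum_{\mu,\nu=1}^n c_\mu c_\nu K(x_\mu,x_\nu)\ge 0$ for all $n\ge1$, all distinct $x_1,\ldots,x_n\in X$ and all real $c_1,\ldots,c_n$. Convention: $t^0=1$ for all $t$. *)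

theory Defs
  imports "HOL-Analysis.Analysis"
begin

section \<open>The real Hilbert space of square-summable sequences\<close>

typedef ell2 = "{x :: nat \<Rightarrow> real. summable (\<lambda>n. (x n)\<^sup>2)}"
  morphisms seq_of Ell2
  by (rule exI[of _ "\<lambda>_. 0"]) simp

setup_lifting type_definition_ell2

lemma summable_mult_ell2:
  fixes x y :: "nat \<Rightarrow> real"
  assumes "summable (\<lambda>n. (x n)\<^sup>2)" "summable (\<lambda>n. (y n)\<^sup>2)"
  shows "summable (\<lambda>n. x n * y n)"
proof (rule summable_comparison_test')
  show "summable (\<lambda>n. (x n)\<^sup>2 + (y n)\<^sup>2)"
    using assms by (rule summable_add)
  have "\<bar>a * b\<bar> \<le> a\<^sup>2 + b\<^sup>2" for a b :: real
  proof -
    have "2 * (\<bar>a\<bar> * \<bar>b\<bar>) \<le> a\<^sup>2 + b\<^sup>2"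
      using sum_squares_bound[of "\<bar>a\<bar>" "\<bar>b\<bar>"] by simp
    moreover have "0 \<le> \<bar>a\<bar> * \<bar>b\<bar>" by simp
    ultimately show ?thesis unfolding abs_mult by linarith
  qed
  then show "norm (x n * y n) \<le> (x n)\<^sup>2 + (y n)\<^sup>2" if "n \<ge> 0" for n
    by simp
qed

lemma summable_add_ell2:
  fixes x y :: "nat \<Rightarrow> real"
  assumes "summable (\<lambda>n. (x n)\<^sup>2)" "summable (\<lambda>n. (y n)\<^sup>2)"
  shows "summable (\<lambda>n. (x n + y n)\<^sup>2)"
proof -
  have "summable (\<lambda>n. (x n)\<^sup>2 + (y n)\<^sup>2 + 2 * (x n * y n))"
    by (intro summable_add summable_mult summable_mult_ell2 assms)
  then show ?thesis by (simp add: power2_sum mult.assoc)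
qed

instantiation ell2 :: real_vector
begin

lift_definition zero_ell2 :: ell2 is "\<lambda>_. 0" by simp

lift_definition plus_ell2 :: "ell2 \<Rightarrow> ell2 \<Rightarrow> ell2" is "\<lambda>x y n. x n + y n"
  by (rule summable_add_ell2)

lift_definition uminus_ell2 :: "ell2 \<Rightarrow> ell2" is "\<lambda>x n. - x n" by simp

lift_definition minus_ell2 :: "ell2 \<Rightarrow> ell2 \<Rightarrow> ell2" is "\<lambda>x y n. x n - y n"
proof -
  fix x y :: "nat \<Rightarrow> real"
  assume "summable (\<lambda>n. (x n)\<^sup>2)" "summable (\<lambda>n. (y n)\<^sup>2)"
  then show "summable (\<lambda>n. (x n - y n)\<^sup>2)"
    using summable_add_ell2[of x "\<lambda>n. - y n"] by simp
qed

lift_definition scaleR_ell2 :: "real \<Rightarrow> ell2 \<Rightarrow> ell2" is "\<lambda>r x n. r * x n"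
  by (simp add: power_mult_distrib summable_mult)

instance
  by standard (transfer; auto simp: algebra_simps)+

end

instantiation ell2 :: real_inner
begin

lift_definition inner_ell2 :: "ell2 \<Rightarrow> ell2 \<Rightarrow> real" is "\<lambda>x y. \<Sum>n. x n * y n" .

definition norm_ell2 :: "ell2 \<Rightarrow> real" where "norm_ell2 x = sqrt (x \<bullet> x)"

definition sgn_ell2 :: "ell2 \<Rightarrow> ell2" where "sgn_ell2 x = x /\<^sub>R norm x"

definition dist_ell2 :: "ell2 \<Rightarrow> ell2 \<Rightarrow> real" where "dist_ell2 x y = norm (x - y)"

definition uniformity_ell2 :: "(ell2 \<times> ell2) filter" where
  "uniformity_ell2 = (INF e\<in>{0<..}. principal {(x, y). dist x y < e})"

definition open_ell2 :: "ell2 set \<Rightarrow> bool" where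
  "open_ell2 U \<longleftrightarrow> (\<forall>x\<in>U. \<forall>\<^sub>F (x', y) in uniformity. x' = x \<longrightarrow> y \<in> U)"

instance
proof
  fix x y z :: ell2 and r :: real and U :: "ell2 set"
  show "dist x y = norm (x - y)" by (fact dist_ell2_def)
  show "sgn x = x /\<^sub>R norm x" by (fact sgn_ell2_def)
  show "uniformity = (INF e\<in>{0<..}. principal {(x :: ell2, y). dist x y < e})"
    by (fact uniformity_ell2_def)
  show "open U \<longleftrightarrow> (\<forall>x\<in>U. \<forall>\<^sub>F (x', y) in uniformity. x' = x \<longrightarrow> y \<in> U)"
    by (fact open_ell2_def)
  show "norm x = sqrt (x \<bullet> x)" by (fact norm_ell2_def)
  show "x \<bullet> y = y \<bullet> x" by transfer (simp add: mult.commute)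
  show "(x + y) \<bullet> z = x \<bullet> z + y \<bullet> z"
    by transfer (simp add: distrib_right suminf_add[symmetric] summable_mult_ell2)
  show "(r *\<^sub>R x) \<bullet> y = r * (x \<bullet> y)"
    by transfer (simp add: mult.assoc suminf_mult summable_mult_ell2)
  show "0 \<le> x \<bullet> x"
    by transfer (simp add: suminf_nonneg power2_eq_square)
  show "x \<bullet> x = 0 \<longleftrightarrow> x = 0"
    by transfer (auto simp: suminf_eq_zero_iff power2_eq_square)
qed

end

section \<open>The sphere with its geodesic distance\<close>

abbreviation Sinf :: "ell2 set" where "Sinf \<equiv> sphere 0 1"

text \<open>The value \<open>0\<close> off the sphere only serves to make the function nonnegative on the
  whole type, as the locale \<^locale>\<open>Metric_space\<close> demands.\<close>

definition geodesic_dist :: "ell2 \<Rightarrow> ell2 \<Rightarrow> real" where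
  "geodesic_dist x y = (if x \<in> Sinf \<and> y \<in> Sinf then arccos (x \<bullet> y) else 0)"

lemma inner_Sinf_bounds:
  assumes "x \<in> Sinf" "y \<in> Sinf"
  shows "- 1 \<le> x \<bullet> y" "x \<bullet> y \<le> 1"
  using Cauchy_Schwarz_ineq2[of x y] assms by (auto simp: abs_le_iff)

lemma geodesic_triangle:
  assumes S: "x \<in> Sinf" "y \<in> Sinf" "z \<in> Sinf"
  shows "geodesic_dist x z \<le> geodesic_dist x y + geodesic_dist y z"
proof -
  define a b c where "a = x \<bullet> z" and "b = x \<bullet> y" and "c = y \<bullet> z"
  have one: "x \<bullet> x = 1" "y \<bullet> y = 1" "z \<bullet> z = 1"
    using S by (auto simp: dot_square_norm)
  have bounds: "- 1 \<le> a" "a \<le> 1" "- 1 \<le> b" "b \<le> 1" "- 1 \<le> c" "c \<le> 1"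
    unfolding a_def b_def c_def using S inner_Sinf_bounds by auto
  define u v where "u = x - b *\<^sub>R y" and "v = z - c *\<^sub>R y"
  have "u \<bullet> u = 1 - b\<^sup>2" "v \<bullet> v = 1 - c\<^sup>2" "u \<bullet> v = a - b * c"
    by (simp_all add: u_def v_def a_def b_def c_def inner_diff_left inner_diff_right one
        inner_commute power2_eq_square algebra_simps)
  then have "b * c - sqrt (1 - b\<^sup>2) * sqrt (1 - c\<^sup>2) \<le> a"
    using Cauchy_Schwarz_ineq2[of u v] by (simp add: norm_eq_sqrt_inner)
  then have cos_le: "cos (arccos b + arccos c) \<le> a"
    using bounds by (simp add: cos_add sin_arccos)
  show ?thesis
  proof (cases "arccos b + arccos c \<le> pi")
    case True
    have nonneg: "0 \<le> arccos b + arccos c"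
      using bounds by (simp add: arccos_lbound)
    have "arccos a \<le> arccos (cos (arccos b + arccos c))"
      using cos_le bounds by (intro arccos_le_arccos) auto
    also have "\<dots> = arccos b + arccos c"
      using True nonneg by (intro arccos_cos)
    finally show ?thesis
      using S by (simp add: geodesic_dist_def a_def b_def c_def)
  next
    case False
    moreover have "arccos a \<le> pi"
      using bounds by (intro arccos_ubound)
    ultimately show ?thesis
      using S by (simp add: geodesic_dist_def a_def b_def c_def)
  qed
qed

lemma inner_Sinf_eq_1_iff:
  assumes "x \<in> Sinf" "y \<in> Sinf"
  shows "x \<bullet> y = 1 \<longleftrightarrow> x = y"
proof -
  have one: "x \<bullet> x = 1" "y \<bullet> y = 1"
    using assms by (auto simp: dot_square_norm)
  have "(x - y) \<bullet> (x - y) = 2 - 2 * (x \<bullet> y)"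
    by (simp add: inner_diff_left inner_diff_right one inner_commute[of y x])
  then have "x \<bullet> y = 1 \<longleftrightarrow> (x - y) \<bullet> (x - y) = 0"
    by linarith
  then show ?thesis by simp
qed

interpretation Sinf: Metric_space Sinf geodesic_dist
proof
  fix x y z :: ell2
  show "0 \<le> geodesic_dist x y"
    unfolding geodesic_dist_def using inner_Sinf_bounds arccos_lbound by auto
  show "geodesic_dist x y = geodesic_dist y x"
    by (simp add: geodesic_dist_def inner_commute)
  show "geodesic_dist x y = 0 \<longleftrightarrow> x = y" if "x \<in> Sinf" "y \<in> Sinf"
    using that inner_Sinf_bounds[OF that] inner_Sinf_eq_1_iff[OF that]
    by (simp add: geodesic_dist_def arccos_eq_0_iff)
  show "geodesic_dist x z \<le> geodesic_dist x y + geodesic_dist y z"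
    if "x \<in> Sinf" "y \<in> Sinf" "z \<in> Sinf"
    using that by (rule geodesic_triangle)
qed

abbreviation Sinf2_topology :: "(ell2 \<times> ell2) topology" where
  "Sinf2_topology \<equiv> prod_topology Sinf.mtopology Sinf.mtopology"

section \<open>Kernels\<close>

definition positive_definite_on :: "'a set \<Rightarrow> ('a \<Rightarrow> 'a \<Rightarrow> real) \<Rightarrow> bool" where
  "positive_definite_on X K \<longleftrightarrow>
    (\<forall>n\<ge>1. \<forall>(x :: nat \<Rightarrow> 'a) (c :: nat \<Rightarrow> real).
      x ` {1..n} \<subseteq> X \<and> inj_on x {1..n} \<longrightarrow>
      (\<Sum>\<mu>=1..n. \<Sum>\<nu>=1..n. c \<mu> * c \<nu> * K (x \<mu>) (x \<nu>)) \<ge> 0)"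

text \<open>Kernels on \<open>S\<^sup>\<infinity> \<times> S\<^sup>\<infinity>\<close> are functions of two arguments, each a pair of points of the
  sphere; only their values on the sphere, and the values of \<open>f\<close> on \<open>[-1,1]\<^sup>2\<close>, matter.\<close>

definition continuous_kernel :: "(ell2 \<times> ell2 \<Rightarrow> ell2 \<times> ell2 \<Rightarrow> real) \<Rightarrow> bool" where
  "continuous_kernel K \<longleftrightarrow>
    continuous_map (prod_topology Sinf2_topology Sinf2_topology) euclideanreal (\<lambda>(p, q). K p q)"

definition isotropic_with_part ::
  "(ell2 \<times> ell2 \<Rightarrow> ell2 \<times> ell2 \<Rightarrow> real) \<Rightarrow> (real \<Rightarrow> real \<Rightarrow> real) \<Rightarrow> bool" where
  "isotropic_with_part K f \<longleftrightarrow>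
    (\<forall>x\<in>Sinf. \<forall>y\<in>Sinf. \<forall>z\<in>Sinf. \<forall>w\<in>Sinf. K (x, z) (y, w) = f (x \<bullet> y) (z \<bullet> w))"

end

theory Submission
  imports Defs
begin

text \<open>
  The substantial direction rests on a coincidence between positive definiteness and Bernstein
  polynomials. Embed the sign patterns \<open>\<epsilon> \<in> {-1,1}\<^sup>N\<close> in the sphere as \<open>\<epsilon> / sqrt N\<close>. The inner product
  of two of them is the mean of the coordinates of their product pattern, so the kernel restricted
  to pairs of such points is translation invariant on a finite group, and positive definiteness
  says that the Walsh coefficients of \<open>(\<epsilon>, \<delta>) \<mapsto> f (mean \<epsilon>) (mean \<delta>)\<close> are nonnegative
  (\<open>walsh_coeff_nonneg\<close>, \<open>positive_definite_walsh_coeff_nonneg\<close>).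

  Now draw \<open>\<epsilon>\<close> and \<open>\<delta>\<close> at random with independent coordinates of mean \<open>t\<close> and \<open>s\<close>. A product of \<open>k\<close>
  coordinates of \<open>\<epsilon>\<close> and \<open>l\<close> coordinates of \<open>\<delta>\<close> has expectation \<open>t\<^sup>k s\<^sup>l\<close>, so the expectation of
  \<open>f (mean \<epsilon>) (mean \<delta>)\<close> is a polynomial in \<open>t, s\<close> whose coefficients are sums of Walsh
  coefficients, hence nonnegative (\<open>bernstein2_has_sum\<close>). On the other hand it is the Bernstein
  polynomial of \<open>f\<close> on the square, and by the law of large numbers it converges to \<open>f\<close>
  (\<open>bernstein2_tendsto\<close>).

  So \<open>f\<close> is a limit of polynomials with nonnegative coefficients whose sums stay bounded. By
  compactness the coefficients converge along a subsequence. Dominated convergence identifies the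
  limit series with \<open>f\<close> in the open square, where the monomials are summable, and then on
  the closed square by radial limits, where the summable limit coefficients dominate
  (\<open>power_series_of_nonneg_approximants\<close>).

  The converse is the Schur product theorem, applied to every monomial
  (\<open>power_series_imp_positive_definite\<close>).
\<close>

section \<open>Random sign patterns\<close>

text \<open>
  A pattern of signs is encoded by the set of positions of the sign \<open>-1\<close>; the group operation on
  patterns, the pointwise product, becomes the symmetric difference of sets.
\<close>

definition sign_at :: "nat set \<Rightarrow> nat \<Rightarrow> real" where
  "sign_at A i = (if i \<in> A then - 1 else 1)"

text \<open>
  The Walsh functions are the characters of the group of sign patterns.
\<close>

definition walsh :: "nat set \<Rightarrow> nat set \<Rightarrow> real" where
  "walsh S A = (\<Prod>i\<in>S. sign_at A i)"

definition mean_sign :: "nat \<Rightarrow> nat set \<Rightarrow> real" where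
  "mean_sign N A = (\<Sum>i<N. sign_at A i) / real N"

text \<open>
  The probability of the pattern \<open>A\<close> on \<open>N\<close> positions when the signs are independent with mean \<open>t\<close>,
  so that each is \<open>1\<close> with probability \<open>(1 + t) / 2\<close>.
\<close>

definition weight :: "nat \<Rightarrow> real \<Rightarrow> nat set \<Rightarrow> real" where
  "weight N t A = (\<Prod>i<N. (1 + t * sign_at A i) / 2)"

lemma sign_sym_diff: "sign_at (sym_diff A B) i = sign_at A i * sign_at B i"
  by (auto simp: sign_at_def)

lemma walsh_sym_diff: "walsh S (sym_diff A B) = walsh S A * walsh S B"
  by (simp add: walsh_def sign_sym_diff prod.distrib del: Un_iff)

lemma abs_mean_sign_le_1: "\<bar>mean_sign N A\<bar> \<le> 1"
proof -
  have "\<bar>\<Sum>i<N. sign_at A i\<bar> \<le> (\<Sum>i<N. \<bar>sign_at A i\<bar>)" by (rule sum_abs)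
  also have "\<dots> = real N" by (simp add: sign_at_def if_distrib cong: if_cong)
  finally show ?thesis by (cases "N = 0") (auto simp: mean_sign_def divide_le_eq)
qed

lemma weight_nonneg:
  assumes "\<bar>t\<bar> \<le> 1"
  shows "0 \<le> weight N t A"
  unfolding weight_def using assms by (intro prod_nonneg) (auto simp: sign_at_def)

text \<open>
  Fourier expansion of the density of a product measure: since a product of \<open>card S\<close> of the signs has
  mean \<open>t ^ card S\<close>, that power is the Walsh coefficient at \<open>S\<close>. Through this expansion a sum
  against \<open>weight N t\<close> becomes a polynomial in \<open>t\<close>.
\<close>

lemma weight_eq_sum_walsh:
  "weight N t A = (\<Sum>S\<in>Pow {..<N}. t ^ card S * walsh S A) / 2 ^ N"
proof -
  have "weight N t A = (\<Prod>i<N. t * sign_at A i + 1) / 2 ^ N"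
    by (simp add: weight_def prod_dividef add.commute)
  also have "(\<Prod>i<N. t * sign_at A i + 1) = (\<Sum>S\<in>Pow {..<N}. t ^ card S * walsh S A)"
    by (simp add: prod_add walsh_def prod.distrib)
  finally show ?thesis .
qed

lemma sum_Pow_lessThan_Suc:
  "(\<Sum>A\<in>Pow {..<Suc N}. g A) = (\<Sum>A\<in>Pow {..<N}. g A + g (insert N A))"
proof -
  have "(\<Sum>A\<in>Pow {..<Suc N}. g A) = sum g (Pow {..<N}) + sum g (insert N ` Pow {..<N})"
    unfolding lessThan_Suc Pow_insert by (rule sum.union_disjoint) auto
  also have "sum g (insert N ` Pow {..<N}) = (\<Sum>A\<in>Pow {..<N}. g (insert N A))"
    by (subst sum.reindex) (auto simp: inj_on_def)
  finally show ?thesis by (simp add: sum.distrib)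
qed

lemma weight_Suc:
  assumes "A \<subseteq> {..<N}"
  shows "weight (Suc N) t A = weight N t A * ((1 + t) / 2)"
    and "weight (Suc N) t (insert N A) = weight N t A * ((1 - t) / 2)"
proof -
  have "sign_at A N = 1" using assms by (auto simp: sign_at_def)
  then show "weight (Suc N) t A = weight N t A * ((1 + t) / 2)"
    by (simp add: weight_def)
  have "sign_at (insert N A) i = sign_at A i" if "i < N" for i using that by (simp add: sign_at_def)
  then show "weight (Suc N) t (insert N A) = weight N t A * ((1 - t) / 2)"
    by (simp add: weight_def) (simp add: sign_at_def)
qed

lemma sum_weight: "(\<Sum>A\<in>Pow {..<N}. weight N t A) = 1"
proof (induction N)
  case 0
  show ?case by (simp add: weight_def)
next
  case (Suc N)
  have "(\<Sum>A\<in>Pow {..<Suc N}. weight (Suc N) t A) = (\<Sum>A\<in>Pow {..<N}. weight N t A)"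
    unfolding sum_Pow_lessThan_Suc
    by (rule sum.cong) (auto simp: weight_Suc field_simps)
  with Suc show ?case by simp
qed

lemma sum_sign_Suc:
  assumes "A \<subseteq> {..<N}"
  shows "(\<Sum>i<Suc N. sign_at A i) = (\<Sum>i<N. sign_at A i) + 1"
    and "(\<Sum>i<Suc N. sign_at (insert N A) i) = (\<Sum>i<N. sign_at A i) - 1"
  using assms by (auto simp: sign_at_def)

text \<open>
  The variance of a sum of \<open>N\<close> independent signs, each of variance \<open>1 - t\<^sup>2\<close>. In the induction step
  the new sign has mean \<open>t\<close>, so the term linear in the old deviation cancels.
\<close>

lemma sum_weight_deviation_squared:
  "(\<Sum>A\<in>Pow {..<N}. weight N t A * ((\<Sum>i<N. sign_at A i) - N * t)\<^sup>2) = N * (1 - t\<^sup>2)"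
proof (induction N)
  case 0
  show ?case by simp
next
  case (Suc N)
  have "(\<Sum>A\<in>Pow {..<Suc N}. weight (Suc N) t A * ((\<Sum>i<Suc N. sign_at A i) - Suc N * t)\<^sup>2)
      = (\<Sum>A\<in>Pow {..<N}. weight N t A * ((\<Sum>i<N. sign_at A i) - N * t)\<^sup>2
          + (1 - t\<^sup>2) * weight N t A)"
    unfolding sum_Pow_lessThan_Suc
  proof (rule sum.cong)
    fix A assume "A \<in> Pow {..<N}"
    then have A: "A \<subseteq> {..<N}" by simp
    show "weight (Suc N) t A * ((\<Sum>i<Suc N. sign_at A i) - Suc N * t)\<^sup>2
        + weight (Suc N) t (insert N A) * ((\<Sum>i<Suc N. sign_at (insert N A) i) - Suc N * t)\<^sup>2
        = weight N t A * ((\<Sum>i<N. sign_at A i) - N * t)\<^sup>2 + (1 - t\<^sup>2) * weight N t A"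
      unfolding weight_Suc[OF A] sum_sign_Suc[OF A]
      by (simp add: power2_eq_square field_simps)
  qed simp
  also have "\<dots> = Suc N * (1 - t\<^sup>2)"
    by (simp add: sum.distrib Suc flip: sum_distrib_left) (simp add: sum_weight algebra_simps)
  finally show ?case .
qed

lemma sum_weight_mean_sign_variance:
  assumes "N > 0"
  shows "(\<Sum>A\<in>Pow {..<N}. weight N t A * (mean_sign N A - t)\<^sup>2) = (1 - t\<^sup>2) / N"
proof -
  have "mean_sign N A - t = ((\<Sum>i<N. sign_at A i) - N * t) / N" for A
    using assms by (simp add: mean_sign_def field_simps)
  then have "(\<Sum>A\<in>Pow {..<N}. weight N t A * (mean_sign N A - t)\<^sup>2)
    = (\<Sum>A\<in>Pow {..<N}. weight N t A * ((\<Sum>i<N. sign_at A i) - N * t)\<^sup>2) / (real N)\<^sup>2"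
    by (simp add: power_divide sum_divide_distrib)
  also have "\<dots> = (1 - t\<^sup>2) / N"
    using assms unfolding sum_weight_deviation_squared by (simp add: power2_eq_square)
  finally show ?thesis .
qed

section \<open>Bernstein polynomials and their power coefficients\<close>

definition sign_patterns :: "nat \<Rightarrow> (nat set \<times> nat set) set" where
  "sign_patterns N = Pow {..<N} \<times> Pow {..<N}"

text \<open>
  The two-variable Bernstein polynomial of \<open>f\<close> on the square \<open>[-1,1]\<^sup>2\<close>. Grouping patterns by
  cardinality gives the usual formula with binomial coefficients; the ungrouped form is the one that
  Fourier analysis on sign patterns sees.
\<close>

definition bernstein2 :: "(real \<Rightarrow> real \<Rightarrow> real) \<Rightarrow> nat \<Rightarrow> real \<Rightarrow> real \<Rightarrow> real" where
  "bernstein2 f N t s =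
    (\<Sum>(A, B)\<in>sign_patterns N. weight N t A * weight N s B * f (mean_sign N A) (mean_sign N B))"

definition walsh_coeff :: "(real \<Rightarrow> real \<Rightarrow> real) \<Rightarrow> nat \<Rightarrow> nat set \<times> nat set \<Rightarrow> real" where
  "walsh_coeff f N = (\<lambda>(S, T).
    (\<Sum>(A, B)\<in>sign_patterns N. walsh S A * walsh T B * f (mean_sign N A) (mean_sign N B)) / 4 ^ N)"

text \<open>
  The coefficient of \<open>t\<^sup>k s\<^sup>l\<close> in \<open>bernstein2 f N t s\<close>, for \<open>kl = (k, l)\<close>: Walsh functions with the same
  numbers of factors have the same expectation.
\<close>

definition power_coeff :: "(real \<Rightarrow> real \<Rightarrow> real) \<Rightarrow> nat \<Rightarrow> nat \<times> nat \<Rightarrow> real" where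
  "power_coeff f N kl =
    (\<Sum>P | P \<in> sign_patterns N \<and> map_prod card card P = kl. walsh_coeff f N P)"

lemma finite_sign_patterns [simp]: "finite (sign_patterns N)"
  by (simp add: sign_patterns_def)

text \<open>
  Expectation of a sum of a function of the first and a function of the second random pattern; each
  total mass is \<open>1\<close>.
\<close>

lemma sum_weight_prod:
  "(\<Sum>(A, B)\<in>sign_patterns N. weight N t A * weight N s B * (g A + h B))
    = (\<Sum>A\<in>Pow {..<N}. weight N t A * g A) + (\<Sum>B\<in>Pow {..<N}. weight N s B * h B)"
proof -
  have "(\<Sum>(A, B)\<in>sign_patterns N. weight N t A * weight N s B * (g A + h B))
      = (\<Sum>A\<in>Pow {..<N}. \<Sum>B\<in>Pow {..<N}.
          weight N t A * g A * weight N s B + weight N t A * (weight N s B * h B))"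
    unfolding sign_patterns_def sum.cartesian_product[symmetric] by (simp add: algebra_simps)
  also have "\<dots> = (\<Sum>A\<in>Pow {..<N}. weight N t A * g A * (\<Sum>B\<in>Pow {..<N}. weight N s B)
      + weight N t A * (\<Sum>B\<in>Pow {..<N}. weight N s B * h B))"
    by (simp add: sum.distrib sum_distrib_left)
  also have "\<dots> = (\<Sum>A\<in>Pow {..<N}. weight N t A * g A)
      + (\<Sum>A\<in>Pow {..<N}. weight N t A) * (\<Sum>B\<in>Pow {..<N}. weight N s B * h B)"
    by (simp only: sum_weight[of N s] mult_1_right sum.distrib sum_distrib_right)
  finally show ?thesis by (simp only: sum_weight mult_1_left)
qed

lemma sum_weight_const:
  "(\<Sum>(A, B)\<in>sign_patterns N. weight N t A * weight N s B * c) = c"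
  using sum_weight_prod[of N t s "\<lambda>_. c" "\<lambda>_. 0"]
  by (simp add: sum_weight flip: sum_distrib_right)

lemma bernstein2_le:
  assumes "\<bar>t\<bar> \<le> 1" "\<bar>s\<bar> \<le> 1"
    and "\<And>u v. u \<in> {-1..1} \<Longrightarrow> v \<in> {-1..1} \<Longrightarrow> f u v \<le> M"
  shows "bernstein2 f N t s \<le> M"
proof -
  have "bernstein2 f N t s \<le> (\<Sum>(A, B)\<in>sign_patterns N. weight N t A * weight N s B * M)"
    unfolding bernstein2_def
  proof (rule sum_mono, clarify)
    fix A B
    have "f (mean_sign N A) (mean_sign N B) \<le> M"
      using abs_mean_sign_le_1[of N A] abs_mean_sign_le_1[of N B] by (intro assms(3)) auto
    then show "weight N t A * weight N s B * f (mean_sign N A) (mean_sign N B)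
        \<le> weight N t A * weight N s B * M"
      using assms by (intro mult_left_mono) (auto simp: weight_nonneg)
  qed
  then show ?thesis by (simp only: sum_weight_const)
qed

text \<open>
  Plancherel's identity: both weights are replaced by their Walsh expansions and the sums are
  interchanged.
\<close>

lemma bernstein2_eq_sum_walsh_coeff:
  "bernstein2 f N t s
    = (\<Sum>(S, T)\<in>sign_patterns N. walsh_coeff f N (S, T) * t ^ card S * s ^ card T)"
proof -
  have "bernstein2 f N t s = (\<Sum>(A, B)\<in>sign_patterns N. \<Sum>(S, T)\<in>sign_patterns N.
      t ^ card S * walsh S A * (s ^ card T * walsh T B) * f (mean_sign N A) (mean_sign N B) / 4 ^ N)"
    unfolding bernstein2_def
  proof (rule sum.cong, simp, clarify)
    fix A B
    have "weight N t A * weight N s B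
        = (\<Sum>(S, T)\<in>sign_patterns N. t ^ card S * walsh S A * (s ^ card T * walsh T B)) / 4 ^ N"
      unfolding weight_eq_sum_walsh sign_patterns_def sum.cartesian_product[symmetric] sum_product[symmetric]
      by (simp flip: power_mult_distrib)
    then show "weight N t A * weight N s B * f (mean_sign N A) (mean_sign N B)
      = (\<Sum>(S, T)\<in>sign_patterns N.
      t ^ card S * walsh S A * (s ^ card T * walsh T B) * f (mean_sign N A) (mean_sign N B) / 4 ^ N)"
      by (simp add: sum_distrib_right sum_divide_distrib case_prod_unfold)
  qed
  also have "\<dots> = (\<Sum>(S, T)\<in>sign_patterns N. \<Sum>(A, B)\<in>sign_patterns N.
      t ^ card S * walsh S A * (s ^ card T * walsh T B) * f (mean_sign N A) (mean_sign N B) / 4 ^ N)"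
    unfolding case_prod_unfold by (rule sum.swap)
  also have "\<dots> = (\<Sum>(S, T)\<in>sign_patterns N. walsh_coeff f N (S, T) * t ^ card S * s ^ card T)"
    by (intro sum.cong refl)
      (simp add: walsh_coeff_def case_prod_unfold sum_distrib_right sum_divide_distrib, simp add: mult_ac)
  finally show ?thesis .
qed

lemma bernstein2_has_sum:
  "((\<lambda>(k, l). power_coeff f N (k, l) * t ^ k * s ^ l) has_sum bernstein2 f N t s) UNIV"
proof (rule has_sum_finite_neutralI)
  show "finite ({..N} \<times> {..N})" by simp
  have img: "map_prod card card ` sign_patterns N \<subseteq> {..N} \<times> {..N}"
    unfolding sign_patterns_def using card_mono[of "{..<N}"] by auto
  show "(case kl of (k, l) \<Rightarrow> power_coeff f N (k, l) * t ^ k * s ^ l) = 0"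
    if "kl \<in> UNIV - {..N} \<times> {..N}" for kl
  proof -
    have "{P \<in> sign_patterns N. map_prod card card P = kl} = {}" using img that by blast
    then have "power_coeff f N kl = 0" by (simp only: power_coeff_def sum.empty)
    then show ?thesis by (simp add: case_prod_unfold)
  qed
  let ?h = "\<lambda>P. walsh_coeff f N P * t ^ card (fst P) * s ^ card (snd P)"
  have "bernstein2 f N t s = sum ?h (sign_patterns N)"
    by (simp add: bernstein2_eq_sum_walsh_coeff case_prod_unfold)
  also have "\<dots> = (\<Sum>kl\<in>{..N} \<times> {..N}.
      sum ?h {P. P \<in> sign_patterns N \<and> map_prod card card P = kl})"
    by (rule sum.group[symmetric]) (use img in auto)
  also have "\<dots> = (\<Sum>kl\<in>{..N} \<times> {..N}. power_coeff f N kl * t ^ fst kl * s ^ snd kl)"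
    unfolding power_coeff_def sum_distrib_right by (intro sum.cong) auto
  finally show "bernstein2 f N t s
      = (\<Sum>(k, l)\<in>{..N} \<times> {..N}. power_coeff f N (k, l) * t ^ k * s ^ l)"
    by (simp add: case_prod_unfold)
qed simp

text \<open>
  The easy half of Bochner's theorem on the group of pairs of patterns. Testing positive definiteness
  against a character, the summand depends only on the product of the two group elements, so the
  double sum collapses to a single one, a positive multiple of the Fourier coefficient.
\<close>

lemma walsh_coeff_nonneg:
  assumes pd: "\<And>c :: nat set \<times> nat set \<Rightarrow> real.
    0 \<le> (\<Sum>(A, B)\<in>sign_patterns N. \<Sum>(A', B')\<in>sign_patterns N. c (A, B) * c (A', B')
          * f (mean_sign N (sym_diff A A')) (mean_sign N (sym_diff B B')))"
  shows "0 \<le> walsh_coeff f N (S, T)"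
proof -
  define c where "c = (\<lambda>(A, B). walsh S A * walsh T B)"
  let ?g = "\<lambda>(A, B). c (A, B) * f (mean_sign N A) (mean_sign N B)"
  have inner: "(\<Sum>(A', B')\<in>sign_patterns N. c (A, B) * c (A', B')
      * f (mean_sign N (sym_diff A A')) (mean_sign N (sym_diff B B'))) = sum ?g (sign_patterns N)"
    if AB: "A \<subseteq> {..<N}" "B \<subseteq> {..<N}" for A B
  proof (rule sum.reindex_bij_witness[where i = "\<lambda>(A', B'). (sym_diff A A', sym_diff B B')"
        and j = "\<lambda>(A', B'). (sym_diff A A', sym_diff B B')"])
    fix P :: "nat set \<times> nat set" assume "P \<in> sign_patterns N"
    moreover obtain A' B' where P: "P = (A', B')" by (cases P)
    show "?g (case P of (A', B') \<Rightarrow> (sym_diff A A', sym_diff B B'))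
      = (case P of (A', B') \<Rightarrow> c (A, B) * c (A', B')
      * f (mean_sign N (sym_diff A A')) (mean_sign N (sym_diff B B')))"
      unfolding P by (simp add: c_def walsh_sym_diff mult_ac)
  qed (use AB in \<open>auto simp: sign_patterns_def\<close>)
  have "0 \<le> (\<Sum>(A, B)\<in>sign_patterns N. \<Sum>(A', B')\<in>sign_patterns N. c (A, B) * c (A', B')
          * f (mean_sign N (sym_diff A A')) (mean_sign N (sym_diff B B')))"
    by (rule pd)
  also have "\<dots> = (\<Sum>P\<in>sign_patterns N. sum ?g (sign_patterns N))"
  proof (rule sum.cong[OF refl], clarify)
    fix A B assume "(A, B) \<in> sign_patterns N"
    then have "A \<subseteq> {..<N}" "B \<subseteq> {..<N}" by (auto simp: sign_patterns_def)
    then show "(\<Sum>(A', B')\<in>sign_patterns N. c (A, B) * c (A', B')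
      * f (mean_sign N (sym_diff A A')) (mean_sign N (sym_diff B B'))) = sum ?g (sign_patterns N)"
      by (rule inner)
  qed
  also have "\<dots> = card (sign_patterns N) * sum ?g (sign_patterns N)"
    by simp
  finally have "0 \<le> real (card (sign_patterns N)) * sum ?g (sign_patterns N)" .
  moreover have "card (sign_patterns N) > 0"
    by (auto simp: card_gt_0_iff) (auto simp: sign_patterns_def)
  ultimately have "0 \<le> sum ?g (sign_patterns N)"
    by (smt (verit) mult_pos_neg of_nat_0_less_iff)
  then show ?thesis by (simp add: walsh_coeff_def c_def)
qed

text \<open>
  Bernstein's proof of the Weierstrass theorem: near \<open>(t, s)\<close> continuity controls the difference,
  away from it the second moment does, and the variance of the mean sign is at most \<open>1 / N\<close>.
\<close>

lemma bernstein2_tendsto: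
  assumes cont: "continuous_on ({-1..1} \<times> {-1..1}) (\<lambda>(u, v). f u v)"
    and t: "t \<in> {-1..1}" and s: "s \<in> {-1..1}"
  shows "(\<lambda>N. bernstein2 f N t s) \<longlonglongrightarrow> f t s"
proof (rule LIMSEQ_I)
  fix e :: real assume e: "e > 0"
  let ?Q = "{-1..1::real} \<times> {-1..1::real}"
  have "compact ?Q" by (intro compact_Times compact_Icc)
  then have "bounded ((\<lambda>(u, v). f u v) ` ?Q)"
    using cont by (intro compact_imp_bounded compact_continuous_image)
  then obtain M where M: "M > 0" "\<And>u v. (u, v) \<in> ?Q \<Longrightarrow> \<bar>f u v\<bar> \<le> M"
    unfolding bounded_pos by force
  obtain d where d: "d > 0"
    "\<And>u v. (u, v) \<in> ?Q \<Longrightarrow> dist (u, v) (t, s) < d \<Longrightarrow> \<bar>f u v - f t s\<bar> < e / 2"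
  proof -
    have "(t, s) \<in> ?Q" using t s by simp
    from bspec[OF cont[unfolded continuous_on_iff] this] e
    obtain d where d: "d > 0" "\<forall>x'\<in>?Q. dist x' (t, s) < d \<longrightarrow>
        dist (case x' of (u, v) \<Rightarrow> f u v) (case (t, s) of (u, v) \<Rightarrow> f u v) < e / 2"
      by (meson half_gt_zero)
    show ?thesis
    proof (rule that[OF d(1)])
      fix u v assume "(u, v) \<in> ?Q" "dist (u, v) (t, s) < d"
      from bspec[OF d(2) this(1)] this(2) show "\<bar>f u v - f t s\<bar> < e / 2"
        by (simp add: dist_real_def)
    qed
  qed
  \<comment> \<open>At distance at least \<open>d\<close> from \<open>(t, s)\<close>, the trivial bound \<open>2 * M\<close> is below \<open>C\<close> times the squared distance.\<close>
  define C where "C = 2 * M / d\<^sup>2"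
  have C: "C > 0" using M d by (simp add: C_def)
  have bound: "\<bar>f u v - f t s\<bar> \<le> e / 2 + C * ((u - t)\<^sup>2 + (v - s)\<^sup>2)" if "(u, v) \<in> ?Q" for u v
  proof (cases "dist (u, v) (t, s) < d")
    case True
    then have "\<bar>f u v - f t s\<bar> < e / 2" using d that by blast
    moreover have "0 \<le> C * ((u - t)\<^sup>2 + (v - s)\<^sup>2)" using C by simp
    ultimately show ?thesis by linarith
  next
    case False
    then have "d\<^sup>2 \<le> (dist (u, v) (t, s))\<^sup>2" using d by (intro power_mono) auto
    also have "\<dots> = (u - t)\<^sup>2 + (v - s)\<^sup>2"
      by (simp add: dist_Pair_Pair dist_real_def)
    finally have "C * d\<^sup>2 \<le> C * ((u - t)\<^sup>2 + (v - s)\<^sup>2)"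
      using C by (intro mult_left_mono) auto
    moreover have "C * d\<^sup>2 = 2 * M" using d by (simp add: C_def)
    moreover have "\<bar>f u v\<bar> \<le> M" "\<bar>f t s\<bar> \<le> M" using M that t s by auto
    ultimately show ?thesis using e by linarith
  qed
  have dev: "\<bar>bernstein2 f N t s - f t s\<bar> \<le> e / 2 + 2 * C / N" if N: "N > 0" for N
  proof -
    have diff: "bernstein2 f N t s - f t s = (\<Sum>(A, B)\<in>sign_patterns N.
        weight N t A * weight N s B * (f (mean_sign N A) (mean_sign N B) - f t s))"
    proof -
      have "bernstein2 f N t s - f t s = bernstein2 f N t s
          - (\<Sum>(A, B)\<in>sign_patterns N. weight N t A * weight N s B * f t s)"
        by (simp only: sum_weight_const)
      then show ?thesis
        by (simp add: bernstein2_def case_prod_unfold right_diff_distrib flip: sum_subtractf)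
    qed
    have abs_le: "\<bar>bernstein2 f N t s - f t s\<bar> \<le> (\<Sum>(A, B)\<in>sign_patterns N. weight N t A * weight N s B *
        ((e / 2 + C * (mean_sign N A - t)\<^sup>2) + C * (mean_sign N B - s)\<^sup>2))"
      (is "_ \<le> ?R")
      unfolding diff
    proof (rule order_trans[OF sum_abs], rule sum_mono, clarify)
      fix A B
      have "(mean_sign N A, mean_sign N B) \<in> ?Q"
        using abs_mean_sign_le_1[of N A] abs_mean_sign_le_1[of N B] by auto
      from bound[OF this]
      have "\<bar>f (mean_sign N A) (mean_sign N B) - f t s\<bar>
          \<le> (e / 2 + C * (mean_sign N A - t)\<^sup>2) + C * (mean_sign N B - s)\<^sup>2"
        by (simp add: algebra_simps)
      moreover have "0 \<le> weight N t A * weight N s B"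
        using t s by (intro mult_nonneg_nonneg weight_nonneg) auto
      ultimately show "\<bar>weight N t A * weight N s B * (f (mean_sign N A) (mean_sign N B) - f t s)\<bar>
        \<le> weight N t A * weight N s B *
        ((e / 2 + C * (mean_sign N A - t)\<^sup>2) + C * (mean_sign N B - s)\<^sup>2)"
        unfolding abs_mult[of "weight N t A * weight N s B"] by (simp add: mult_left_mono)
    qed
    have R: "?R = (\<Sum>A\<in>Pow {..<N}. weight N t A * (e / 2 + C * (mean_sign N A - t)\<^sup>2))
        + (\<Sum>B\<in>Pow {..<N}. weight N s B * (C * (mean_sign N B - s)\<^sup>2))"
      by (rule sum_weight_prod)
    have R1: "(\<Sum>A\<in>Pow {..<N}. weight N t A * (e / 2 + C * (mean_sign N A - t)\<^sup>2))
        = (\<Sum>A\<in>Pow {..<N}. weight N t A) * (e / 2)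
          + C * (\<Sum>A\<in>Pow {..<N}. weight N t A * (mean_sign N A - t)\<^sup>2)"
      unfolding sum_distrib_left sum_distrib_right sum.distrib[symmetric]
      by (rule sum.cong) (simp_all add: algebra_simps)
    have R2: "(\<Sum>B\<in>Pow {..<N}. weight N s B * (C * (mean_sign N B - s)\<^sup>2))
        = C * (\<Sum>B\<in>Pow {..<N}. weight N s B * (mean_sign N B - s)\<^sup>2)"
      unfolding sum_distrib_left by (rule sum.cong) (simp_all add: mult.left_commute)
    have "?R = e / 2 + C * ((1 - t\<^sup>2) / N) + C * ((1 - s\<^sup>2) / N)"
      unfolding R R1 R2 sum_weight_mean_sign_variance[OF N] sum_weight by simp
    also have "\<dots> \<le> e / 2 + C * (1 / N) + C * (1 / N)"
      using C N by (intro add_mono mult_left_mono divide_right_mono) auto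
    finally have "?R \<le> e / 2 + 2 * C / N" by simp
    with abs_le show ?thesis by (rule order_trans)
  qed
  obtain N0 :: nat where N0: "4 * C / e < N0" using reals_Archimedean2 by blast
  have "norm (bernstein2 f N t s - f t s) < e" if "N \<ge> N0" for N
  proof -
    have "0 < 4 * C / e" using C e by simp
    then have N: "N > 0" "4 * C / e < N" using N0 that by linarith+
    then have "2 * C / N < e / 2" using e by (simp add: field_simps)
    then show ?thesis using dev[OF N(1)] by simp
  qed
  then show "\<exists>N0. \<forall>N\<ge>N0. norm (bernstein2 f N t s - f t s) < e" by blast
qed

section \<open>Limits of polynomials with nonnegative coefficients\<close>

lemma summable_on_comparison_test_real:
  fixes f g :: "'a \<Rightarrow> real"
  assumes "g summable_on A" and "\<And>x. x \<in> A \<Longrightarrow> \<bar>f x\<bar> \<le> g x"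
  shows "f summable_on A"
proof -
  have "(\<lambda>x. \<bar>f x\<bar>) summable_on A"
    by (rule summable_on_comparison_test[OF assms]) auto
  then show ?thesis by (simp add: summable_on_iff_abs_summable_on_real[of f])
qed

text \<open>
  Tannery's theorem for unordered sums: the bound makes the partial sums converge uniformly in \<open>n\<close>,
  which allows the two limits to be exchanged.
\<close>

lemma infsum_tendsto_dominated:
  fixes a :: "nat \<Rightarrow> 'a \<Rightarrow> real"
  assumes lim: "\<And>x. (\<lambda>n. a n x) \<longlonglongrightarrow> b x"
    and bound: "\<And>n x. \<bar>a n x\<bar> \<le> M x"
    and summable: "M summable_on UNIV"
  shows "(\<lambda>n. \<Sum>\<^sub>\<infinity>x. a n x) \<longlonglongrightarrow> (\<Sum>\<^sub>\<infinity>x. b x)"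
proof (rule swap_uniform_limit')
  have "\<bar>b x\<bar> \<le> M x" for x
    using lim[of x] bound by (intro LIMSEQ_le_const2[OF tendsto_rabs]) auto
  then have "b summable_on UNIV"
    by (rule summable_on_comparison_test_real[OF summable])
  then show "((\<lambda>F. sum b F) \<longlongrightarrow> (\<Sum>\<^sub>\<infinity>x. b x)) (finite_subsets_at_top UNIV)"
    by (rule infsum_tendsto)
  show "\<forall>\<^sub>F F in finite_subsets_at_top UNIV. (\<lambda>n. sum (a n) F) \<longlonglongrightarrow> sum b F"
    by (intro always_eventually allI tendsto_sum lim)
  show "uniform_limit UNIV (\<lambda>F n. sum (a n) F) (\<lambda>n. \<Sum>\<^sub>\<infinity>x. a n x) (finite_subsets_at_top UNIV)"
    using bound summable by (intro Weierstrass_m_test_general) auto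
qed auto

text \<open>
  By Tychonoff's theorem the cube \<open>[0,M]\<^sup>I\<close> is compact, and for a countable index set it is metrizable,
  hence sequentially compact.
\<close>

lemma bounded_nonneg_subseq_pointwise_convergent:
  fixes a :: "nat \<Rightarrow> 'a::countable \<Rightarrow> real"
  assumes "\<And>n x. a n x \<in> {0..M}"
  obtains b r where "strict_mono (r :: nat \<Rightarrow> nat)" "\<And>x. (\<lambda>n. a (r n) x) \<longlonglongrightarrow> b x"
proof -
  have "compactin (product_topology (\<lambda>_::'a. euclidean) UNIV) (PiE UNIV (\<lambda>_. {0..M}))"
    unfolding compactin_PiE by simp
  then have "compact (PiE UNIV (\<lambda>_::'a. {0..M}))"
    by (simp add: euclidean_product_topology)
  then have "seq_compact (PiE UNIV (\<lambda>_::'a. {0..M}))"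
    by (simp add: compact_eq_seq_compact_metric)
  moreover have "\<forall>n. a n \<in> PiE UNIV (\<lambda>_. {0..M})" using assms by auto
  ultimately obtain b r where r: "strict_mono (r :: nat \<Rightarrow> nat)" and lim: "(a \<circ> r) \<longlonglongrightarrow> b"
    by (rule seq_compactE)
  have "(\<lambda>n. a (r n) x) \<longlonglongrightarrow> b x" for x
  proof -
    have "isCont (\<lambda>g :: 'a \<Rightarrow> real. g x) b"
      using continuous_on_product_coordinates[of x] continuous_on_eq_continuous_at open_UNIV by blast
    from isCont_tendsto_compose[OF this lim] show ?thesis by (simp add: o_def)
  qed
  with r that show ?thesis by blast
qed

lemma power_prod_summable:
  fixes t s :: real
  assumes "\<bar>t\<bar> < 1" "\<bar>s\<bar> < 1"
  shows "(\<lambda>(k, l). \<bar>t\<bar> ^ k * \<bar>s\<bar> ^ l) summable_on UNIV"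
proof -
  have "(\<lambda>k. \<bar>t\<bar> ^ k) summable_on UNIV" "(\<lambda>k. \<bar>s\<bar> ^ k) summable_on UNIV"
    using assms by (auto intro!: summable_nonneg_imp_summable_on summable_geometric)
  then have "(\<lambda>(k, l). \<bar>t\<bar> ^ k * \<bar>s\<bar> ^ l) summable_on UNIV \<times> UNIV"
    by (intro summable_on_SigmaI[where g = "\<lambda>k. \<bar>t\<bar> ^ k * (\<Sum>\<^sub>\<infinity>l. \<bar>s\<bar> ^ l)"]
        summable_on_cmult_left) (simp_all add: has_sum_cmult_right)
  then show ?thesis by simp
qed

text \<open>
  The limit step. Nonnegativity with bounded coefficient sums serves twice: it makes the coefficients
  bounded, hence convergent along a subsequence, and by Fatou it makes the limit coefficients summable.
  A priori mass may escape to infinite degree in the limit, so on the boundary of the square the approximants give no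
  direct information; the identity there is recovered from the interior by continuity.
\<close>

lemma power_series_of_nonneg_approximants:
  fixes c :: "nat \<Rightarrow> nat \<times> nat \<Rightarrow> real" and f :: "real \<Rightarrow> real \<Rightarrow> real"
  assumes cont: "continuous_on ({-1..1} \<times> {-1..1}) (\<lambda>(u, v). f u v)"
    and nonneg: "\<And>N kl. 0 \<le> c N kl"
    and sum_le: "\<And>N. (c N has_sum m N) UNIV" "\<And>N. m N \<le> M"
    and p: "\<And>N t s. t \<in> {-1..1} \<Longrightarrow> s \<in> {-1..1} \<Longrightarrow>
      ((\<lambda>(k, l). c N (k, l) * t ^ k * s ^ l) has_sum p N t s) UNIV"
    and lim: "\<And>t s. t \<in> {-1..1} \<Longrightarrow> s \<in> {-1..1} \<Longrightarrow> (\<lambda>N. p N t s) \<longlonglongrightarrow> f t s"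
  obtains a where "\<And>kl. 0 \<le> a kl" "a summable_on UNIV"
    "\<And>t s. t \<in> {-1..1} \<Longrightarrow> s \<in> {-1..1} \<Longrightarrow>
      ((\<lambda>(k, l). a (k, l) * t ^ k * s ^ l) has_sum f t s) UNIV"
proof -
  have finite_sum_le: "sum (c N) F \<le> M" if "finite F" for N F
    using finite_sum_le_has_sum[OF sum_le(1)[of N] that] nonneg sum_le(2)[of N] by fastforce
  have "c N kl \<in> {0..M}" for N kl
    using finite_sum_le[of "{kl}" N] nonneg by simp
  then obtain a r where r: "strict_mono (r :: nat \<Rightarrow> nat)" and a: "\<And>kl. (\<lambda>N. c (r N) kl) \<longlonglongrightarrow> a kl"
    by (rule bounded_nonneg_subseq_pointwise_convergent[of c M]) (rule that)
  have a0: "0 \<le> a kl" for kl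
    by (rule LIMSEQ_le_const[OF a]) (blast intro: nonneg)
  have aM: "sum a F \<le> M" if "finite F" for F
    using finite_sum_le[OF that]
    by (intro LIMSEQ_le_const2[OF tendsto_sum[of F "\<lambda>kl N. c (r N) kl", OF a]]) auto
  have summable: "a summable_on UNIV"
    using a0 aM by (intro nonneg_bdd_above_summable_on) (auto simp: bdd_above_def)
  define g where "g t s = (\<Sum>\<^sub>\<infinity>(k, l). a (k, l) * t ^ k * s ^ l)" for t s
  have le_a: "\<bar>a kl * t ^ fst kl * s ^ snd kl\<bar> \<le> a kl"
    if "t \<in> {-1..1}" "s \<in> {-1..1}" for t s kl
  proof -
    have "\<bar>t\<bar> ^ fst kl * \<bar>s\<bar> ^ snd kl \<le> 1"
      using that by (intro mult_le_one power_le_one) auto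
    then show ?thesis
      using mult_left_mono[OF _ a0[of kl]] a0[of kl]
      by (fastforce simp: abs_mult power_abs mult.assoc)
  qed
  have interior: "f t s = g t s" if "\<bar>t\<bar> < 1" "\<bar>s\<bar> < 1" for t s
  proof -
    have ts: "t \<in> {-1..1}" "s \<in> {-1..1}" using that by auto
    have "(\<lambda>N. \<Sum>\<^sub>\<infinity>(k, l). c (r N) (k, l) * t ^ k * s ^ l) \<longlonglongrightarrow> g t s"
      unfolding g_def
    proof (rule infsum_tendsto_dominated)
      show "(\<lambda>kl. M * (case kl of (k, l) \<Rightarrow> \<bar>t\<bar> ^ k * \<bar>s\<bar> ^ l)) summable_on UNIV"
        by (intro summable_on_cmult_right power_prod_summable that)
      show "(\<lambda>N. case kl of (k, l) \<Rightarrow> c (r N) (k, l) * t ^ k * s ^ l)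
          \<longlonglongrightarrow> (case kl of (k, l) \<Rightarrow> a (k, l) * t ^ k * s ^ l)" for kl
        unfolding case_prod_unfold by (simp, intro tendsto_intros a)
      show "\<bar>case kl of (k, l) \<Rightarrow> c (r N) (k, l) * t ^ k * s ^ l\<bar>
          \<le> M * (case kl of (k, l) \<Rightarrow> \<bar>t\<bar> ^ k * \<bar>s\<bar> ^ l)" for N kl
        using finite_sum_le[of "{kl}" "r N"] nonneg[of "r N" kl]
        by (auto simp: case_prod_unfold abs_mult power_abs mult.assoc intro!: mult_right_mono)
    qed
    moreover have "(\<Sum>\<^sub>\<infinity>(k, l). c (r N) (k, l) * t ^ k * s ^ l) = p (r N) t s" for N
      using p[OF ts] by (rule infsumI)
    ultimately have "(\<lambda>N. p (r N) t s) \<longlonglongrightarrow> g t s" by simp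
    moreover have "(\<lambda>N. p (r N) t s) \<longlonglongrightarrow> f t s"
      using LIMSEQ_subseq_LIMSEQ[OF lim[OF ts] r] by (simp add: o_def)
    ultimately show ?thesis by (rule LIMSEQ_unique[rotated])
  qed
  have equal: "f t s = g t s" if ts: "t \<in> {-1..1}" "s \<in> {-1..1}" for t s
  proof -
    \<comment> \<open>Radii increasing to \<open>1\<close> move the point into the open square.\<close>
    define q where "q n = 1 - 1 / real (Suc (Suc n))" for n
    have q: "0 \<le> q n" "q n < 1" for n by (auto simp: q_def field_simps)
    have q1: "q \<longlonglongrightarrow> 1" unfolding q_def by real_asymp
    have qt: "\<bar>q n * u\<bar> < 1" if "u \<in> {-1..1}" for n u
    proof -
      have "\<bar>q n * u\<bar> \<le> q n * 1"
        unfolding abs_mult using that q[of n] by (intro mult_mono) auto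
      with q[of n] show ?thesis by simp
    qed
    have square: "(q n * t, q n * s) \<in> {-1..1} \<times> {-1..1}" for n
      using qt[OF ts(1), of n] qt[OF ts(2), of n] by (simp add: abs_less_iff)
    have "(\<lambda>n. (q n * t, q n * s)) \<longlonglongrightarrow> (1 * t, 1 * s)"
      by (intro tendsto_intros q1)
    then have "(\<lambda>n. (q n * t, q n * s)) \<longlonglongrightarrow> (t, s)" by simp
    from continuous_on_tendsto_compose[OF cont this] ts square
    have "(\<lambda>n. f (q n * t) (q n * s)) \<longlonglongrightarrow> f t s" by simp
    moreover have "(\<lambda>n. g (q n * t) (q n * s)) \<longlonglongrightarrow> g t s"
      unfolding g_def
    proof (rule infsum_tendsto_dominated[OF _ _ summable])
      fix kl :: "nat \<times> nat"
      show "(\<lambda>n. case kl of (k, l) \<Rightarrow> a (k, l) * (q n * t) ^ k * (q n * s) ^ l)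
          \<longlonglongrightarrow> (case kl of (k, l) \<Rightarrow> a (k, l) * t ^ k * s ^ l)"
      proof -
        have "(\<lambda>n. a kl * (q n * t) ^ fst kl * (q n * s) ^ snd kl)
          \<longlonglongrightarrow> a kl * (1 * t) ^ fst kl * (1 * s) ^ snd kl"
          by (intro tendsto_intros q1)
        then show ?thesis by (simp add: case_prod_unfold)
      qed
      show "\<bar>case kl of (k, l) \<Rightarrow> a (k, l) * (q n * t) ^ k * (q n * s) ^ l\<bar> \<le> a kl" for n
        using le_a[of "q n * t" "q n * s" kl] qt[OF ts(1), of n] qt[OF ts(2), of n]
        by (simp add: case_prod_unfold abs_less_iff)
    qed
    moreover have "f (q n * t) (q n * s) = g (q n * t) (q n * s)" for n
      by (intro interior qt ts)
    ultimately show ?thesis by (simp add: LIMSEQ_unique)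
  qed
  show ?thesis
  proof (rule that[OF a0 summable])
    fix t s :: real assume ts: "t \<in> {-1..1}" "s \<in> {-1..1}"
    have "(\<lambda>kl. a kl * t ^ fst kl * s ^ snd kl) summable_on UNIV"
      by (rule summable_on_comparison_test_real[OF summable]) (use le_a[OF ts] in auto)
    then show "((\<lambda>(k, l). a (k, l) * t ^ k * s ^ l) has_sum f t s) UNIV"
      unfolding equal[OF ts] g_def by (intro has_sum_infsum) (simp add: case_prod_unfold)
  qed
qed

section \<open>The cube inside the sphere\<close>

definition finite_vec :: "nat \<Rightarrow> (nat \<Rightarrow> real) \<Rightarrow> ell2" where
  "finite_vec N g = Ell2 (\<lambda>i. if i < N then g i else 0)"

lemma seq_of_finite_vec: "seq_of (finite_vec N g) = (\<lambda>i. if i < N then g i else 0)"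
  unfolding finite_vec_def
  by (rule Ell2_inverse) (auto intro!: summable_finite[of "{..<N}"] split: if_splits)

lemma inner_finite_vec: "finite_vec N g \<bullet> finite_vec N h = (\<Sum>i<N. g i * h i)"
  unfolding inner_ell2.rep_eq seq_of_finite_vec
  by (subst suminf_finite[of "{..<N}"]) auto

lemma in_Sinf_iff: "x \<in> Sinf \<longleftrightarrow> x \<bullet> x = 1"
  by (simp add: norm_eq_1)

text \<open>
  The vertices of the cube, scaled to unit length.
\<close>

definition cube_vec :: "nat \<Rightarrow> nat set \<Rightarrow> ell2" where
  "cube_vec N A = finite_vec N (\<lambda>i. sign_at A i / sqrt N)"

text \<open>
  The inner product depends only on the product of the two sign patterns. This is the link between
  isotropy and translation invariance on the group of patterns.
\<close>

lemma inner_cube_vec: "cube_vec N A \<bullet> cube_vec N B = mean_sign N (sym_diff A B)"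
  unfolding cube_vec_def inner_finite_vec mean_sign_def sign_sym_diff
  by (simp add: sum_divide_distrib)

lemma cube_vec_in_Sinf:
  assumes "N > 0"
  shows "cube_vec N A \<in> Sinf"
  unfolding in_Sinf_iff inner_cube_vec using assms by (simp add: mean_sign_def sign_at_def)

lemma inj_on_cube_vec: "inj_on (cube_vec N) (Pow {..<N})"
proof (rule inj_onI)
  fix A B assume AB: "A \<in> Pow {..<N}" "B \<in> Pow {..<N}" and eq: "cube_vec N A = cube_vec N B"
  have "i \<in> A \<longleftrightarrow> i \<in> B" if "i < N" for i
  proof -
    have "sign_at A i / sqrt N = sign_at B i / sqrt N"
      using fun_cong[OF arg_cong[OF eq, of seq_of], of i] that
      by (simp add: cube_vec_def seq_of_finite_vec)
    with that show ?thesis by (auto simp: sign_at_def split: if_splits)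
  qed
  with AB show "A = B" by blast
qed

lemma positive_definite_on_finite:
  assumes "positive_definite_on X K" "finite I" "inj_on p I" "p ` I \<subseteq> X"
  shows "0 \<le> (\<Sum>i\<in>I. \<Sum>j\<in>I. c i * c j * K (p i) (p j))"
proof (cases "I = {}")
  case False
  obtain h where h: "bij_betw h {1..card I} I"
    using ex_bij_betw_nat_finite_1[OF assms(2)] by blast
  have "1 \<le> card I" using False assms(2) by (simp add: Suc_le_eq card_gt_0_iff)
  moreover have "(p \<circ> h) ` {1..card I} \<subseteq> X"
    using h assms(4) by (auto simp: bij_betw_def)
  moreover have "inj_on (p \<circ> h) {1..card I}"
    using h assms(3) by (intro comp_inj_on) (auto simp: bij_betw_def)
  ultimately have "0 \<le> (\<Sum>\<mu>=1..card I. \<Sum>\<nu>=1..card I.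
      (c \<circ> h) \<mu> * (c \<circ> h) \<nu> * K ((p \<circ> h) \<mu>) ((p \<circ> h) \<nu>))"
    using assms(1) unfolding positive_definite_on_def by blast
  also have "\<dots> = (\<Sum>\<mu>=1..card I. \<Sum>j\<in>I. c (h \<mu>) * c j * K (p (h \<mu>)) (p j))"
    unfolding o_def by (intro sum.cong refl sum.reindex_bij_betw[OF h])
  also have "\<dots> = (\<Sum>i\<in>I. \<Sum>j\<in>I. c i * c j * K (p i) (p j))"
    by (rule sum.reindex_bij_betw[OF h])
  finally show ?thesis .
qed simp

lemma isotropicD:
  assumes "isotropic_with_part K f" "p \<in> Sinf \<times> Sinf" "q \<in> Sinf \<times> Sinf"
  shows "K p q = f (fst p \<bullet> fst q) (snd p \<bullet> snd q)"
  using assms unfolding isotropic_with_part_def by (cases p; cases q) auto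

lemma positive_definite_walsh_coeff_nonneg:
  assumes iso: "isotropic_with_part K f" and pd: "positive_definite_on (Sinf \<times> Sinf) K"
    and N: "N > 0"
  shows "0 \<le> walsh_coeff f N P"
proof -
  obtain S T where P: "P = (S, T)" by (cases P)
  show ?thesis unfolding P
  proof (rule walsh_coeff_nonneg)
    fix c :: "nat set \<times> nat set \<Rightarrow> real"
    let ?p = "map_prod (cube_vec N) (cube_vec N)"
    have inS: "?p Q \<in> Sinf \<times> Sinf" for Q
      using cube_vec_in_Sinf[OF N] by (cases Q) (simp del: mem_sphere_0)
    have "0 \<le> (\<Sum>Q\<in>sign_patterns N. \<Sum>R\<in>sign_patterns N. c Q * c R * K (?p Q) (?p R))"
    proof (rule positive_definite_on_finite[OF pd finite_sign_patterns])
      show "inj_on ?p (sign_patterns N)"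
        unfolding sign_patterns_def by (intro map_prod_inj_on inj_on_cube_vec)
      show "?p ` sign_patterns N \<subseteq> Sinf \<times> Sinf" by (rule image_subsetI) (rule inS)
    qed
    also have "\<dots> = (\<Sum>(A, B)\<in>sign_patterns N. \<Sum>(A', B')\<in>sign_patterns N. c (A, B) * c (A', B')
          * f (mean_sign N (sym_diff A A')) (mean_sign N (sym_diff B B')))"
      unfolding isotropicD[OF iso inS inS]
      by (simp add: inner_cube_vec case_prod_unfold)
    finally show "0 \<le> \<dots>" .
  qed
qed

section \<open>Continuity of the isotropic part\<close>

text \<open>
  Half of a great circle from \<open>-e\<close> to \<open>e\<close>, parametrised by the inner product with its endpoint
  \<open>e = unit_arc 1\<close>.
\<close>

definition unit_arc :: "real \<Rightarrow> ell2" where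
  "unit_arc t = finite_vec 2 (\<lambda>i. if i = 0 then t else sqrt (1 - t\<^sup>2))"

lemma inner_arc: "unit_arc t \<bullet> unit_arc u = t * u + sqrt (1 - t\<^sup>2) * sqrt (1 - u\<^sup>2)"
  by (simp add: unit_arc_def inner_finite_vec numeral_2_eq_2)

lemma arc_in_Sinf:
  assumes "t \<in> {-1..1}"
  shows "unit_arc t \<in> Sinf"
proof -
  have "t\<^sup>2 \<le> 1" using assms by (simp add: abs_square_le_1 abs_le_iff)
  then show ?thesis by (simp only: in_Sinf_iff inner_arc) (simp flip: power2_eq_square)
qed

lemma geodesic_dist_arc:
  assumes "t \<in> {-1..1}" "u \<in> {-1..1}"
  shows "geodesic_dist (unit_arc t) (unit_arc u) = \<bar>arccos t - arccos u\<bar>"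
proof -
  have "unit_arc t \<bullet> unit_arc u = cos (arccos t - arccos u)"
    using assms by (simp add: inner_arc cos_diff sin_arccos)
  moreover have "\<bar>arccos t - arccos u\<bar> \<le> pi"
    using assms arccos_bounded[of t] arccos_bounded[of u] by (simp add: abs_le_iff)
  ultimately show ?thesis
    using assms arc_in_Sinf by (simp add: geodesic_dist_def arccos_cos_eq_abs del: mem_sphere_0)
qed

lemma continuous_map_arc: "continuous_map (top_of_set {-1..1}) Sinf.mtopology unit_arc"
  unfolding Sinf.continuous_map_to_metric
proof (intro ballI allI impI)
  fix t e :: real assume t: "t \<in> topspace (top_of_set {-1..1})" and e: "e > 0"
  let ?U = "{-1..1} \<inter> arccos -` ball (arccos t) e"
  have "openin (top_of_set {-1..1}) ?U"
    by (intro continuous_openin_preimage_gen continuous_on_arccos' open_ball)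
  moreover have "t \<in> ?U" using t e by simp
  moreover have "unit_arc u \<in> Sinf.mball (unit_arc t) e" if "u \<in> ?U" for u
    using that t arc_in_Sinf
    by (auto simp: Sinf.in_mball geodesic_dist_arc dist_real_def simp del: mem_sphere_0)
  ultimately show "\<exists>U. openin (top_of_set {-1..1}) U \<and> t \<in> U \<and> (\<forall>u\<in>U. unit_arc u \<in> Sinf.mball (unit_arc t) e)"
    by blast
qed

text \<open>
  With one argument of the kernel fixed at \<open>(e, e)\<close>, \<open>e = unit_arc 1\<close>, and both components of the other
  moving along the half circle, every pair of inner products occurs, so \<open>f\<close> is a composition of the
  kernel with continuous maps.
\<close>

lemma continuous_on_isotropic_part:
  assumes cont: "continuous_kernel K" and iso: "isotropic_with_part K f"
  shows "continuous_on ({-1..1} \<times> {-1..1}) (\<lambda>(t, s). f t s)"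
proof -
  let ?Q = "{-1..1::real} \<times> {-1..1::real}"
  let ?pole = "(unit_arc 1, unit_arc 1)"
  have "continuous_map (top_of_set ?Q) (top_of_set {-1..1}) fst"
    "continuous_map (top_of_set ?Q) (top_of_set {-1..1}) snd"
    by (auto simp: continuous_map_in_subtopology intro: continuous_on_fst continuous_on_snd continuous_on_id)
  from this[THEN continuous_map_compose[OF _ continuous_map_arc]]
  have "continuous_map (top_of_set ?Q) (prod_topology Sinf2_topology Sinf2_topology)
      (\<lambda>p. (?pole, (unit_arc (fst p), unit_arc (snd p))))"
    using arc_in_Sinf[of 1]
    by (intro continuous_map_pairedI) (auto simp: o_def simp del: mem_sphere_0)
  from continuous_map_compose[OF this cont[unfolded continuous_kernel_def]]
  have "continuous_on ?Q (\<lambda>p. K ?pole (unit_arc (fst p), unit_arc (snd p)))"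
    by (simp add: o_def)
  moreover have "K ?pole (unit_arc (fst p), unit_arc (snd p)) = (case p of (t, s) \<Rightarrow> f t s)" if "p \<in> ?Q" for p
  proof -
    have "unit_arc (fst p) \<in> Sinf" "unit_arc (snd p) \<in> Sinf" "unit_arc 1 \<in> Sinf"
      using that by (auto intro!: arc_in_Sinf simp del: mem_sphere_0 mem_sphere)
    then have "K ?pole (unit_arc (fst p), unit_arc (snd p)) = f (unit_arc 1 \<bullet> unit_arc (fst p)) (unit_arc 1 \<bullet> unit_arc (snd p))"
      using isotropicD[OF iso, of ?pole "(unit_arc (fst p), unit_arc (snd p))"] by (simp del: mem_sphere_0)
    then show ?thesis by (simp add: inner_arc case_prod_unfold)
  qed
  ultimately show ?thesis by (subst continuous_on_cong[OF refl]) auto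
qed

section \<open>Schur products of Gram matrices\<close>

lemma sums_inner_ell2: "(\<lambda>n. seq_of x n * seq_of y n) sums (x \<bullet> y)"
  unfolding inner_ell2.rep_eq using seq_of[of x] seq_of[of y]
  by (intro summable_sums summable_mult_ell2) auto

text \<open>
  Schur product theorem with a Gram matrix as one factor: the Gram matrix is a sum of rank-one matrices,
  one for each coordinate of the vectors, and multiplying by a rank-one matrix only rescales the test
  coefficients.
\<close>

lemma quadratic_form_mult_inner_nonneg:
  fixes v :: "'a \<Rightarrow> ell2" and c :: "'a \<Rightarrow> real"
  assumes M: "\<And>c. 0 \<le> (\<Sum>i\<in>I. \<Sum>j\<in>I. c i * c j * M i j)"
  shows "0 \<le> (\<Sum>i\<in>I. \<Sum>j\<in>I. c i * c j * (M i j * (v i \<bullet> v j)))"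
proof (rule sums_le[OF _ sums_zero])
  show "(\<lambda>n. \<Sum>i\<in>I. \<Sum>j\<in>I. c i * c j * (M i j * (seq_of (v i) n * seq_of (v j) n)))
      sums (\<Sum>i\<in>I. \<Sum>j\<in>I. c i * c j * (M i j * (v i \<bullet> v j)))"
    by (intro sums_sum sums_mult sums_inner_ell2)
  show "0 \<le> (\<Sum>i\<in>I. \<Sum>j\<in>I. c i * c j * (M i j * (seq_of (v i) n * seq_of (v j) n)))" for n
    using M[of "\<lambda>i. c i * seq_of (v i) n"] by (simp add: mult_ac)
qed

lemma quadratic_form_inner_power_nonneg:
  fixes v :: "'a \<Rightarrow> ell2"
  assumes "\<And>c :: 'a \<Rightarrow> real. 0 \<le> (\<Sum>i\<in>I. \<Sum>j\<in>I. c i * c j * M i j)"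
  shows "0 \<le> (\<Sum>i\<in>I. \<Sum>j\<in>I. c i * c j * (M i j * (v i \<bullet> v j) ^ k))"
proof (induction k arbitrary: c)
  case 0
  show ?case using assms by simp
next
  case (Suc k)
  show ?case using quadratic_form_mult_inner_nonneg[OF Suc.IH, of c v] by (simp add: mult_ac)
qed

lemma quadratic_form_monomial_nonneg:
  fixes v w :: "'a \<Rightarrow> ell2"
  shows "0 \<le> (\<Sum>i\<in>I. \<Sum>j\<in>I. c i * c j * ((v i \<bullet> v j) ^ k * (w i \<bullet> w j) ^ l))"
proof (rule quadratic_form_inner_power_nonneg)
  fix c :: "'a \<Rightarrow> real"
  have "0 \<le> (\<Sum>i\<in>I. \<Sum>j\<in>I. c i * c j * (1 * (v i \<bullet> v j) ^ k))"
    by (rule quadratic_form_inner_power_nonneg) (simp flip: sum_product)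
  then show "0 \<le> (\<Sum>i\<in>I. \<Sum>j\<in>I. c i * c j * (v i \<bullet> v j) ^ k)" by simp
qed

lemma has_sum_finite_sum:
  fixes g :: "'i \<Rightarrow> 'a \<Rightarrow> real"
  assumes "\<And>i. i \<in> I \<Longrightarrow> (g i has_sum s i) A"
  shows "((\<lambda>x. \<Sum>i\<in>I. g i x) has_sum (\<Sum>i\<in>I. s i)) A"
  using assms by (induction I rule: infinite_finite_induct) (auto intro: has_sum_add)

text \<open>
  Each monomial yields a nonnegative quadratic form, and a convergent sum of nonnegative multiples of such
  forms is nonnegative.
\<close>

lemma power_series_imp_positive_definite:
  fixes a :: "nat \<Rightarrow> nat \<Rightarrow> real"
  assumes iso: "isotropic_with_part K f"
    and nonneg: "\<And>k l. 0 \<le> a k l"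
    and series: "\<And>t s. t \<in> {-1..1} \<Longrightarrow> s \<in> {-1..1} \<Longrightarrow>
      ((\<lambda>(k, l). a k l * t ^ k * s ^ l) has_sum f t s) UNIV"
  shows "positive_definite_on (Sinf \<times> Sinf) K"
  unfolding positive_definite_on_def
proof (intro allI impI, elim conjE)
  fix n and x :: "nat \<Rightarrow> ell2 \<times> ell2" and c :: "nat \<Rightarrow> real"
  assume x: "x ` {1..n} \<subseteq> Sinf \<times> Sinf"
  let ?t = "\<lambda>\<mu> \<nu>. fst (x \<mu>) \<bullet> fst (x \<nu>)" and ?s = "\<lambda>\<mu> \<nu>. snd (x \<mu>) \<bullet> snd (x \<nu>)"
  have monomial: "((\<lambda>(k, l). c \<mu> * c \<nu> * (a k l * ?t \<mu> \<nu> ^ k * ?s \<mu> \<nu> ^ l))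
      has_sum c \<mu> * c \<nu> * K (x \<mu>) (x \<nu>)) UNIV" if "\<mu> \<in> {1..n}" "\<nu> \<in> {1..n}" for \<mu> \<nu>
  proof -
    have S: "x \<mu> \<in> Sinf \<times> Sinf" "x \<nu> \<in> Sinf \<times> Sinf" using that x by blast+
    then have "?t \<mu> \<nu> \<in> {-1..1}" "?s \<mu> \<nu> \<in> {-1..1}"
      unfolding mem_Times_iff using inner_Sinf_bounds by (auto simp del: mem_sphere_0)
    from has_sum_cmult_right[OF series[OF this]] show ?thesis
      unfolding isotropicD[OF iso S] by (simp add: case_prod_unfold)
  qed
  have "((\<lambda>kl. \<Sum>\<mu>=1..n. \<Sum>\<nu>=1..n.
        case kl of (k, l) \<Rightarrow> c \<mu> * c \<nu> * (a k l * ?t \<mu> \<nu> ^ k * ?s \<mu> \<nu> ^ l))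
      has_sum (\<Sum>\<mu>=1..n. \<Sum>\<nu>=1..n. c \<mu> * c \<nu> * K (x \<mu>) (x \<nu>))) UNIV"
    by (intro has_sum_finite_sum monomial)
  then show "0 \<le> (\<Sum>\<mu>=1..n. \<Sum>\<nu>=1..n. c \<mu> * c \<nu> * K (x \<mu>) (x \<nu>))"
  proof (rule has_sum_nonneg)
    fix kl :: "nat \<times> nat"
    obtain k l where kl: "kl = (k, l)" by (cases kl)
    have "0 \<le> a k l * (\<Sum>\<mu>=1..n. \<Sum>\<nu>=1..n. c \<mu> * c \<nu> * (?t \<mu> \<nu> ^ k * ?s \<mu> \<nu> ^ l))"
      by (intro mult_nonneg_nonneg nonneg quadratic_form_monomial_nonneg)
    then show "0 \<le> (\<Sum>\<mu>=1..n. \<Sum>\<nu>=1..n.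
        case kl of (k, l) \<Rightarrow> c \<mu> * c \<nu> * (a k l * ?t \<mu> \<nu> ^ k * ?s \<mu> \<nu> ^ l))"
      by (simp add: kl sum_distrib_left mult_ac)
  qed
qed

section \<open>The characterisation\<close>

lemma positive_definite_imp_power_series:
  assumes cont: "continuous_kernel K" and iso: "isotropic_with_part K f"
    and pd: "positive_definite_on (Sinf \<times> Sinf) K"
  obtains a where "\<And>kl. 0 \<le> a kl" "a summable_on UNIV"
    "\<And>t s. t \<in> {-1..1} \<Longrightarrow> s \<in> {-1..1} \<Longrightarrow>
      ((\<lambda>(k, l). a (k, l) * t ^ k * s ^ l) has_sum f t s) UNIV"
proof -
  note contf = continuous_on_isotropic_part[OF cont iso]
  have "compact ((\<lambda>(t, s). f t s) ` ({-1..1} \<times> {-1..1}))"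
    by (intro compact_continuous_image contf compact_Times compact_Icc)
  then obtain M where M: "\<And>p. p \<in> {-1..1} \<times> {-1..1} \<Longrightarrow> \<bar>case p of (t, s) \<Rightarrow> f t s\<bar> \<le> M"
    unfolding real_norm_def[symmetric] by (metis (mono_tags, lifting) bounded_iff compact_imp_bounded imageI)
  show ?thesis
  \<comment> \<open>\<open>Suc N\<close> because there is no unit vector \<open>cube_vec 0 A\<close>.\<close>
  proof (rule power_series_of_nonneg_approximants[OF contf])
    show "0 \<le> power_coeff f (Suc N) kl" for N kl
      unfolding power_coeff_def
      by (intro sum_nonneg positive_definite_walsh_coeff_nonneg[OF iso pd]) simp
    show "(power_coeff f (Suc N) has_sum bernstein2 f (Suc N) 1 1) UNIV" for N
      using bernstein2_has_sum[of f "Suc N" 1 1] by simp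
    show "bernstein2 f (Suc N) 1 1 \<le> M" for N
      using M by (intro bernstein2_le) (auto intro: abs_le_D1)
    show "((\<lambda>(k, l). power_coeff f (Suc N) (k, l) * t ^ k * s ^ l) has_sum bernstein2 f (Suc N) t s) UNIV"
      for N t s by (rule bernstein2_has_sum)
    show "(\<lambda>N. bernstein2 f (Suc N) t s) \<longlonglongrightarrow> f t s" if "t \<in> {-1..1}" "s \<in> {-1..1}" for t s
      using bernstein2_tendsto[OF contf that] by (rule LIMSEQ_Suc)
  qed (rule that)
qed

theorem theorem3p5:
  fixes K :: "ell2 \<times> ell2 \<Rightarrow> ell2 \<times> ell2 \<Rightarrow> real"
    and f :: "real \<Rightarrow> real \<Rightarrow> real"
  assumes "continuous_kernel K"
    and "isotropic_with_part K f"
  shows "positive_definite_on (Sinf \<times> Sinf) K \<longleftrightarrow>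
    (\<exists>a :: nat \<Rightarrow> nat \<Rightarrow> real.
      (\<forall>k l. 0 \<le> a k l) \<and>
      (\<lambda>(k, l). a k l) summable_on UNIV \<and>
      (\<forall>t\<in>{-1..1}. \<forall>s\<in>{-1..1}.
        ((\<lambda>(k, l). a k l * t ^ k * s ^ l) has_sum f t s) UNIV))"
  (is "_ \<longleftrightarrow> (\<exists>a. ?series a)")
proof
  assume pd: "positive_definite_on (Sinf \<times> Sinf) K"
  show "\<exists>a. ?series a"
  proof (rule positive_definite_imp_power_series[OF assms pd])
    fix a :: "nat \<times> nat \<Rightarrow> real"
    assume "\<And>kl. 0 \<le> a kl" "a summable_on UNIV"
      "\<And>t s. t \<in> {-1..1} \<Longrightarrow> s \<in> {-1..1} \<Longrightarrow>
        ((\<lambda>(k, l). a (k, l) * t ^ k * s ^ l) has_sum f t s) UNIV"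
    then show ?thesis
      by (intro exI[of _ "\<lambda>k l. a (k, l)"] conjI allI ballI) simp_all
  qed
next
  assume "\<exists>a. ?series a"
  then obtain a :: "nat \<Rightarrow> nat \<Rightarrow> real" where a: "?series a" by (rule exE)
  show "positive_definite_on (Sinf \<times> Sinf) K"
  proof (rule power_series_imp_positive_definite[OF assms(2)])
    show "0 \<le> a k l" for k l using a by blast
    show "((\<lambda>(k, l). a k l * t ^ k * s ^ l) has_sum f t s) UNIV"
      if "t \<in> {-1..1}" "s \<in> {-1..1}" for t s
      using a that by blast
  qed
qed

end
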